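(* For every $n\ge 2$, the Mycielskian graph $\mu(P_n)$ of the path $P_n$ of order $n$ satisfies $\gamma_p(\mu(P_n))=1$.
   Context: All graphs are finite, simple and undirected. $N[v]$ denotes the closed neighborhood of $v$ and $N[S]=\bigcup_{v\in S}N[v]$. For $U\subseteq V(G)$, the closure $cl(U)$ is the set obtained from $U$ by repeatedly applying, until no more changes are possible, the rule: if a vertex $u$ is in the current set and exactly one neighbor $w$ of $u$ is not in it, then add $w$. A set $S\subseteq V(G)$ is a power dominating set of $G$ if $cl(N[S])=V(G)$, and the power domination number $\gamma_p(G)$ is the minimum cardinality of a power dominating set. For a graph $G$ with vertex set $V=\{v_1,\dots,v_n\}$, the Mycielskian graph $\mu(G)$ has vertex set $V\cup\{u_1,\dots,u_n\}\cup\{w\}$ (all these vertices distinct) and edge set $E(G)\cup\{u_iv_j : v_iv_j\in E(G)\}\cup\{u_iw : 1\le i\le n\}$. *)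

theory Defs
  imports "Graph_Theory.Pair_Digraph"
begin

text \<open>
  Finite simple undirected graphs are modelled as in the entry Graph\_Theory: by the locale
  \<^locale>\<open>pair_graph\<close>, i.e. finite, loop-free, symmetric digraphs without parallel arcs. An
  undirected edge is the pair of its two opposite arcs.
\<close>

section \<open>Power domination\<close>

definition nbhd :: "'a pair_pre_digraph \<Rightarrow> 'a \<Rightarrow> 'a set" where
  "nbhd G v = {u. (v, u) \<in> parcs G}"

definition closed_nbhd :: "'a pair_pre_digraph \<Rightarrow> 'a \<Rightarrow> 'a set" where
  "closed_nbhd G v = insert v (nbhd G v)"

definition closed_nbhd_set :: "'a pair_pre_digraph \<Rightarrow> 'a set \<Rightarrow> 'a set" where
  "closed_nbhd_set G S = (\<Union>v\<in>S. closed_nbhd G v)"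

inductive force_step :: "'a pair_pre_digraph \<Rightarrow> 'a set \<Rightarrow> 'a set \<Rightarrow> bool"
  for G :: "'a pair_pre_digraph" where
  "\<lbrakk>u \<in> U; nbhd G u - U = {w}\<rbrakk> \<Longrightarrow> force_step G U (insert w U)"

text \<open>
  The closure is the result of an exhaustive sequence of forcing steps. Lemma
  \<open>forcing_closure_ex1\<close> below shows that in a finite graph such a sequence exists and that
  its result does not depend on the order of the steps.
\<close>

definition forcing_closure :: "'a pair_pre_digraph \<Rightarrow> 'a set \<Rightarrow> 'a set" where
  "forcing_closure G U = (THE C. (force_step G)\<^sup>*\<^sup>* U C \<and> \<not> (\<exists>D. force_step G C D))"

definition power_dominating_set :: "'a pair_pre_digraph \<Rightarrow> 'a set \<Rightarrow> bool" where
  "power_dominating_set G S \<longleftrightarrow>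
     S \<subseteq> pverts G \<and> forcing_closure G (closed_nbhd_set G S) = pverts G"

definition power_domination_number :: "'a pair_pre_digraph \<Rightarrow> nat" where
  "power_domination_number G = (LEAST k. \<exists>S. power_dominating_set G S \<and> card S = k)"

lemma force_steps_subset_final:
  assumes "(force_step G)\<^sup>*\<^sup>* U D" and "U \<subseteq> C" and "\<not> (\<exists>D. force_step G C D)"
  shows "D \<subseteq> C"
  using assms(1)
proof (induction rule: rtranclp_induct)
  case base
  show ?case by (fact assms(2))
next
  case (step D D')
  from step.hyps(2) obtain u w where uw: "u \<in> D" "nbhd G u - D = {w}" "D' = insert w D"
    by (auto elim: force_step.cases)
  have "w \<in> C"
  proof (rule ccontr)
    assume "w \<notin> C"
    with uw step.IH have "nbhd G u - C = {w}" by blast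
    with uw step.IH have "force_step G C (insert w C)" by (blast intro: force_step.intros)
    with assms(3) show False by blast
  qed
  with uw step.IH show ?case by blast
qed

lemma force_steps_mono: "(force_step G)\<^sup>*\<^sup>* U D \<Longrightarrow> U \<subseteq> D"
  by (induction rule: rtranclp_induct) (auto elim: force_step.cases)

lemma (in pair_fin_digraph) ex_final_force_steps:
  "\<exists>C. (force_step G)\<^sup>*\<^sup>* U C \<and> \<not> (\<exists>D. force_step G C D)"
proof (induction "card (pverts G - U)" arbitrary: U rule: less_induct)
  case less
  show ?case
  proof (cases "\<exists>D. force_step G U D")
    case False
    then show ?thesis by blast
  next
    case True
    then obtain D where D: "force_step G U D" by blast
    then obtain u w where uw: "nbhd G u - U = {w}" "D = insert w U"
      by (auto elim: force_step.cases)
    from uw have "w \<in> pverts G - U" by (auto simp: nbhd_def dest: in_arcsD2)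
    with uw have "pverts G - D \<subset> pverts G - U" by blast
    with pair_finite_verts have "card (pverts G - D) < card (pverts G - U)"
      by (intro psubset_card_mono) auto
    from less[OF this] D show ?thesis by (meson converse_rtranclp_into_rtranclp)
  qed
qed

lemma (in pair_fin_digraph) forcing_closure_ex1:
  "\<exists>!C. (force_step G)\<^sup>*\<^sup>* U C \<and> \<not> (\<exists>D. force_step G C D)"
  using ex_final_force_steps force_steps_subset_final force_steps_mono
  by (metis subset_antisym)

section \<open>Paths and Mycielskians\<close>

definition path_graph :: "nat \<Rightarrow> nat pair_pre_digraph" where
  "path_graph n = \<lparr>pverts = {1..n},
     parcs = {(i, j). i \<in> {1..n} \<and> j \<in> {1..n} \<and> (j = i + 1 \<or> i = j + 1)}\<rparr>"

text \<open>\<open>Orig v\<^sub>i\<close>, \<open>Shadow v\<^sub>i\<close> and \<open>Apex\<close> are the vertices \<open>v\<^sub>i\<close>, \<open>u\<^sub>i\<close> and \<open>w\<close>.\<close>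

datatype 'a mycielski_vertex = Orig 'a | Shadow 'a | Apex

definition mycielskian :: "'a pair_pre_digraph \<Rightarrow> 'a mycielski_vertex pair_pre_digraph" where
  "mycielskian G = \<lparr>pverts = Orig ` pverts G \<union> Shadow ` pverts G \<union> {Apex},
     parcs = {(Orig x, Orig y) | x y. (x, y) \<in> parcs G}
       \<union> {(Shadow x, Orig y) | x y. (x, y) \<in> parcs G}
       \<union> {(Orig y, Shadow x) | x y. (x, y) \<in> parcs G}
       \<union> {(Shadow x, Apex) | x. x \<in> pverts G}
       \<union> {(Apex, Shadow x) | x. x \<in> pverts G}\<rparr>"

lemma pair_graph_path_graph: "pair_graph (path_graph n)"
proof -
  have "finite (parcs (path_graph n))"
    by (rule finite_subset[of _ "{1..n} \<times> {1..n}"]) (auto simp: path_graph_def)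
  then show ?thesis
    by unfold_locales (auto simp: path_graph_def symmetric_def intro!: symI)
qed

lemma pair_graph_mycielskian:
  assumes "pair_graph G"
  shows "pair_graph (mycielskian G)"
proof -
  interpret pair_graph G by fact
  have "parcs (mycielskian G) \<subseteq> pverts (mycielskian G) \<times> pverts (mycielskian G)"
    by (auto simp: mycielskian_def dest: in_arcsD1 in_arcsD2)
  moreover have fin: "finite (pverts (mycielskian G))"
    using pair_finite_verts by (simp add: mycielskian_def)
  ultimately have "finite (parcs (mycielskian G))"
    by (meson finite_SigmaI finite_subset)
  with fin show ?thesis
    by unfold_locales
      (auto simp: mycielskian_def symmetric_def
         intro!: symI dest: in_arcsD1 in_arcsD2 arcs_symmetric no_loops')
qed

end

theory Submission
  imports Defs
begin

text \<open>
  The single vertex \<open>v\<^sub>2\<close> power dominates \<open>\<mu>(P\<^sub>n)\<close>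
  (\<open>power_dominating_set_mycielskian_path\<close>). Its closed neighbourhood contains \<open>v\<^sub>1\<close> and
  \<open>u\<^sub>1\<close>, and \<open>u\<^sub>1\<close> has only the neighbours \<open>v\<^sub>2\<close> and \<open>w\<close>, so it forces the apex \<open>w\<close>. From then on
  the forcing sweeps along the path: once \<open>w\<close> and all \<open>v\<^sub>i\<close>, \<open>u\<^sub>i\<close> with \<open>i \<le> k\<close> are reached, the
  only neighbour of \<open>u\<^sub>k\<close> that can be missing is \<open>v\<^bsub>k+1\<^esub>\<close>, so \<open>u\<^sub>k\<close> forces it, and after that the
  only neighbour of \<open>v\<^sub>k\<close> that can be missing is \<open>u\<^bsub>k+1\<^esub>\<close>. The choice of
  \<open>v\<^sub>2\<close> is what lets \<open>w\<close> be reached: it is the only original vertex adjacent to \<open>u\<^sub>1\<close>. For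
  \<open>n \<ge> 3\<close>, starting at \<open>v\<^sub>1\<close> gets stuck at once, because \<open>u\<^sub>2\<close> misses both \<open>v\<^sub>3\<close> and \<open>w\<close>, and
  \<open>v\<^sub>2\<close> misses \<open>v\<^sub>3\<close>, \<open>u\<^sub>1\<close> and \<open>u\<^sub>3\<close>.

  The forcing argument never follows a particular sequence of steps. It only uses that the closure
  is stable under forcing (\<open>forcing_closure_forced\<close>), so it suffices to derive membership of
  each vertex in turn.

  Conversely, no vertex can force anything from the empty set, so the power domination number of a
  nonempty graph is positive (\<open>power_domination_number_eq_1\<close>).
\<close>

context pair_fin_digraph
begin

lemma forcing_closure_reachable: "(force_step G)\<^sup>*\<^sup>* U (forcing_closure G U)"
  and forcing_closure_final: "\<not> (\<exists>D. force_step G (forcing_closure G U) D)"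
  using theI'[OF forcing_closure_ex1[of U]] unfolding forcing_closure_def by auto

lemma subset_forcing_closure: "U \<subseteq> forcing_closure G U"
  by (rule force_steps_mono[OF forcing_closure_reachable])

lemma forcing_closure_forced:
  assumes "u \<in> forcing_closure G U" and "w \<in> nbhd G u"
    and "nbhd G u \<subseteq> insert w (forcing_closure G U)"
  shows "w \<in> forcing_closure G U"
proof (rule ccontr)
  assume "w \<notin> forcing_closure G U"
  with assms have "nbhd G u - forcing_closure G U = {w}" by blast
  with assms(1) forcing_closure_final show False by (blast intro: force_step.intros)
qed

lemma forcing_closure_subset_verts:
  assumes "U \<subseteq> pverts G"
  shows "forcing_closure G U \<subseteq> pverts G"
proof (rule force_steps_subset_final[OF forcing_closure_reachable assms])
  have "nbhd G u - pverts G = {}" for u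
    by (auto simp: nbhd_def dest: in_arcsD2)
  then show "\<not> (\<exists>D. force_step G (pverts G) D)"
    by (auto elim!: force_step.cases)
qed

lemma closed_nbhd_set_subset_verts:
  "S \<subseteq> pverts G \<Longrightarrow> closed_nbhd_set G S \<subseteq> pverts G"
  by (auto simp: closed_nbhd_set_def closed_nbhd_def nbhd_def dest: in_arcsD2)

lemma forcing_closure_empty: "forcing_closure G {} = {}"
  using force_steps_subset_final[OF forcing_closure_reachable, of "{}" "{}"]
  by (auto elim: force_step.cases)

lemma power_domination_number_eq_1:
  assumes "power_dominating_set G {v}"
  shows "power_domination_number G = 1"
  unfolding power_domination_number_def
proof (rule Least_equality)
  show "\<exists>S. power_dominating_set G S \<and> card S = 1"
    using assms by (intro exI[of _ "{v}"]) simp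
next
  fix k
  assume "\<exists>S. power_dominating_set G S \<and> card S = k"
  then obtain S where S: "power_dominating_set G S" "card S = k" by blast
  have "finite S"
    using S(1) pair_finite_verts by (auto simp: power_dominating_set_def intro: finite_subset)
  moreover have "S \<noteq> {}"
    using S(1) assms
    by (auto simp: power_dominating_set_def closed_nbhd_set_def forcing_closure_empty)
  ultimately show "1 \<le> k"
    using S(2) by (auto simp: Suc_le_eq card_gt_0_iff)
qed

end

lemma (in pair_graph) nbhd_mycielskian_Orig:
  "nbhd (mycielskian G) (Orig x) = Orig ` nbhd G x \<union> Shadow ` nbhd G x"
  by (auto simp: nbhd_def mycielskian_def intro: arcs_symmetric)

lemma nbhd_mycielskian_Shadow:
  "x \<in> pverts G \<Longrightarrow> nbhd (mycielskian G) (Shadow x) = insert Apex (Orig ` nbhd G x)"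
  by (auto simp: nbhd_def mycielskian_def)

text \<open>
  The sweep along the path is an induction on the index. The hypothesis has to cover every smaller
  index, because forcing from index \<open>k\<close> requires the neighbours at index \<open>k - 1\<close> to be reached.
\<close>

lemma power_dominating_set_mycielskian_path:
  assumes "n \<ge> 2"
  shows "power_dominating_set (mycielskian (path_graph n)) {Orig 2}"
proof -
  let ?M = "mycielskian (path_graph n)"
  define C where "C = forcing_closure ?M (closed_nbhd_set ?M {Orig 2})"
  interpret M: pair_graph ?M
    by (intro pair_graph_mycielskian pair_graph_path_graph)
  have start: "{Orig 2} \<subseteq> pverts ?M"
    using assms by (auto simp: mycielskian_def path_graph_def)
  have forced: "w \<in> C" if "u \<in> C" "w \<in> nbhd ?M u" "nbhd ?M u \<subseteq> insert w C" for u w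
    using M.forcing_closure_forced that unfolding C_def by blast
  have nbhd_path: "nbhd (path_graph n) i = {j \<in> {1..n}. j = i + 1 \<or> i = j + 1}"
    if "i \<in> {1..n}" for i
    using that by (auto simp: nbhd_def path_graph_def)
  note nbhd_Orig = pair_graph.nbhd_mycielskian_Orig[OF pair_graph_path_graph] nbhd_path
  have nbhd_Shadow: "nbhd ?M (Shadow i)
      = insert Apex (Orig ` {j \<in> {1..n}. j = i + 1 \<or> i = j + 1})"
    if "i \<in> {1..n}" for i
    using that nbhd_mycielskian_Shadow[of i "path_graph n"] nbhd_path[OF that]
    by (simp add: path_graph_def)

  have "closed_nbhd_set ?M {Orig 2} \<subseteq> C"
    unfolding C_def by (rule M.subset_forcing_closure)
  then have O2: "Orig 2 \<in> C" and O1: "Orig 1 \<in> C" and S1: "Shadow 1 \<in> C"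
    using assms by (auto simp: closed_nbhd_set_def closed_nbhd_def nbhd_Orig)
  have apex: "Apex \<in> C"
    by (rule forced[OF S1]) (use assms O2 in \<open>auto simp: nbhd_Shadow numeral_2_eq_2\<close>)

  have sweep: "Orig i \<in> C \<and> Shadow i \<in> C" if "i \<in> {1..n}" for i
    using that
  proof (induction i rule: less_induct)
    case (less i)
    show ?case
    proof (cases "i = 1")
      case True
      then show ?thesis using O1 S1 by simp
    next
      case False
      define k where "k = i - 1"
      have k: "i = Suc k" "k \<in> {1..n}"
        using False less.prems by (auto simp: k_def)
      have reached: "Orig j \<in> C \<and> Shadow j \<in> C" if "j \<in> {1..k}" for j
        using less.IH[of j] that k by auto
      have "Orig k \<in> C" "Shadow k \<in> C"
        using reached k(2) by auto
      have orig: "Orig i \<in> C"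
        by (rule forced[OF \<open>Shadow k \<in> C\<close>])
          (use less.prems k reached apex in \<open>auto simp: nbhd_Shadow\<close>)
      moreover have "Shadow i \<in> C"
        by (rule forced[OF \<open>Orig k \<in> C\<close>])
          (use less.prems k reached orig in \<open>auto simp: nbhd_Orig\<close>)
      ultimately show ?thesis by blast
    qed
  qed

  have "pverts ?M \<subseteq> C"
    using sweep apex by (auto simp: mycielskian_def path_graph_def)
  moreover have "C \<subseteq> pverts ?M"
    unfolding C_def
    by (intro M.forcing_closure_subset_verts M.closed_nbhd_set_subset_verts start)
  ultimately show ?thesis
    using start by (auto simp: power_dominating_set_def C_def)
qed

theorem theorem23:
  fixes n :: nat
  assumes "n \<ge> 2"
  shows "power_domination_number (mycielskian (path_graph n)) = 1"
proof -
  interpret M: pair_graph "mycielskian (path_graph n)"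
    by (intro pair_graph_mycielskian pair_graph_path_graph)
  show ?thesis
    by (rule M.power_domination_number_eq_1[OF power_dominating_set_mycielskian_path[OF assms]])
qed

end
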